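(* Let $(L,[-,-],N,\alpha,\beta)$ be an involutive Nijenhuis BiHom-Lie algebra, let $S:L\to L$ be a linear map that is adjoint-admissible to $(L,[-,-],N,\alpha,\beta)$, let $r\in L\otimes L$, and let $\Delta_r:L\to L\otimes L$ be $\Delta_r(x)=(\mathrm{ad}_x\otimes\beta+\beta\otimes\mathrm{ad}_{\alpha^{-1}\beta(x)})r$. Suppose that $(L,[-,-],\Delta_r,\alpha,\beta)$ is a BiHom-Lie bialgebra. If $$r=-\tau(r)\qquad\text{and}\qquad(S\otimes\mathrm{id}-\mathrm{id}\otimes N)(r)=0,$$ then $(L,[-,-],N,\Delta_r,S,\alpha,\beta)$ is a Nijenhuis BiHom-Lie bialgebra.
   Context: All vector spaces are finite-dimensional over a field $\mathbf k$; $\langle\cdot,\cdot\rangle$ is the natural pairing of a space with its dual; $\tau(x\otimes y)=y\otimes x$; $\mathrm{ad}_x(y)=[x,y]$. **BiHom-Lie algebra** $(L,[-,-],\alpha,\beta)$: a vector space $L$, a bilinear map $[-,-]$ and two commuting linear maps $\alpha,\beta$ on $L$ with $\alpha([x,y])=[\alpha(x),\alpha(y)]$, $\beta([x,y])=[\beta(x),\beta(y)]$, $[\beta(x),\alpha(y)]=-[\beta(y),\alpha(x)]$ and $[\beta^2(x),[\beta(y),\alpha(z)]]+[\beta^2(y),[\beta(z),\alpha(x)]]+[\beta^2(z),[\beta(x),\alpha(y)]]=0$. It is **involutive** if $\alpha^2=\beta^2=\mathrm{id}_L$. **Nijenhuis BiHom-Lie algebra** $(L,[-,-],N,\alpha,\beta)$: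 a BiHom-Lie algebra with a linear map $N:L\to L$ commuting with $\alpha$ and $\beta$ such that $[N(x),N(y)]=N([N(x),y]+[x,N(y)])-N^2([x,y])$. It is involutive if the underlying BiHom-Lie algebra is. **BiHom-Lie coalgebra** $(L,\Delta,\alpha,\beta)$: commuting linear maps $\alpha,\beta$ and a linear map $\Delta:L\to L\otimes L$ with $\Delta\alpha=(\alpha\otimes\alpha)\Delta$, $\Delta\beta=(\beta\otimes\beta)\Delta$, $(\beta\otimes\alpha)\Delta+\tau(\beta\otimes\alpha)\Delta=0$, and, with $J=(\mathrm{id}\otimes\beta\otimes\alpha)(\beta^2\otimes\Delta)\Delta$, $J+(\tau\otimes\mathrm{id})(\mathrm{id}\otimes\tau)J+(\mathrm{id}\otimes\tau)(\tau\otimes\mathrm{id})J=0$. **BiHom-Lie bialgebra** $(L,[-,-],\Delta,\alpha,\beta)$: $(L,[-,-],\alpha,\beta)$ is a BiHom-Lie algebra, $(L,\Delta,\alpha,\beta)$ is a BiHom-Lie coalgebra, $\alpha$ is invertible, and for all $x,y\in L$ $$\Delta([\alpha^{-1}\beta(x),y])=(\mathrm{ad}_{\beta(x)}\otimes\beta+\beta\otimes\mathrm{ad}_{\alpha^{-1}\beta^2(x)})\Delta(y)-(\mathrm{ad}_{\beta(y)}\otimes\beta+\beta\otimes\mathrm{ad}_{\alpha^{-1}\beta^2(y)})\Delta(x).$$ **Nijenhuis BiHom-Lie coalgebra** $(L,\Delta,S,\alpha,\beta)$: a BiHom-Lie coalgebra with a linear map $S:L\to L$ such that $(S\otimes S)\Delta+\Delta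 S^2=(S\otimes\mathrm{id})\Delta S+(\mathrm{id}\otimes S)\Delta S$. **Representations.** A representation of a BiHom-Lie algebra $(L,[-,-],\alpha,\beta)$ is $(V,\rho,p,q)$ with $p,q$ commuting linear maps on $V$ and $\rho:L\to\mathfrak{gl}(V)$ linear such that $p(\rho(x)v)=\rho(\alpha(x))p(v)$, $q(\rho(x)v)=\rho(\beta(x))q(v)$, $\rho([\beta(x),y])q(v)=\rho(\alpha\beta(x))\rho(y)v-\rho(\beta(y))\rho(\alpha(x))v$. A representation of a Nijenhuis BiHom-Lie algebra $(L,[-,-],N,\alpha,\beta)$ is $(V,\rho,\eta,p,q)$ where $(V,\rho,p,q)$ is a representation of the BiHom-Lie algebra and $\eta:V\to V$ is linear, commutes with $p$ and $q$, and satisfies $\rho(N(x))\eta(v)=\eta(\rho(N(x))v)+\eta(\rho(x)\eta(v))-\eta^2(\rho(x)v)$. **Duals and adjoint-admissibility.** For a linear map $f$, $\langle f^*(a^* ),x\rangle=\langle a^*,f(x)\rangle$; $\langle\mathrm{ad}^*(x)b^*,y\rangle=-\langle b^*,[x,y]\rangle$; $\Delta^*:L^*\otimes L^*\to L^*$ is $\langle\Delta^*(a^*\otimes b^* ),x\rangle=\langle a^*\otimes b^*,\Delta(x)\rangle$. A linear map $S:L\to L$ is adjoint-admissible to an involutive Nijenhuis BiHom-Lie algebra $(L,[-,-],N,\alpha,\beta)$ if $(L^*,\mathrm{ad}^*,S^*,\alpha^*,\beta^* )$ is a representation of it and $S([N(x),y])+[x,S^2(y)]=[N(x),S(y)]+S([x,S(y)])$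 for all $x,y$. **Nijenhuis BiHom-Lie bialgebra** $(L,[-,-],N,\Delta,S,\alpha,\beta)$: (i) $(L,[-,-],\Delta,\alpha,\beta)$ is a BiHom-Lie bialgebra; (ii) $(L,[-,-],N,\alpha,\beta)$ is an involutive Nijenhuis BiHom-Lie algebra; (iii) $(L,\Delta,S,\alpha,\beta)$ is a Nijenhuis BiHom-Lie coalgebra; (iv) $S$ is adjoint-admissible to $(L,[-,-],N,\alpha,\beta)$; (v) $N^*$ is adjoint-admissible to $(L^*,\Delta^*,S^*,\alpha^*,\beta^* )$. *)

theory Defs
  imports Complex_Main "HOL-Library.Function_Algebras"
begin

text \<open>
  A vector space is a subspace \<open>V\<close>, spanned by a finite set, of a type carrying a scalar
  multiplication \<open>s\<close>. Working with subspaces rather than whole types lets a space, its dual and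
  its double dual be treated by the same definitions. Maps are total functions of
  which only the values on the carrier matter.
\<close>

locale fd_space = vector_space s
  for s :: "'k::field \<Rightarrow> 'v::ab_group_add \<Rightarrow> 'v" +
  fixes V :: "'v set"
  assumes finitely_spanned: "\<exists>B. finite B \<and> V = span B"

lemma (in fd_space)
  shows carrier_zero: "0 \<in> V"
    and carrier_add: "\<lbrakk>x \<in> V; y \<in> V\<rbrakk> \<Longrightarrow> x + y \<in> V"
    and carrier_scale: "x \<in> V \<Longrightarrow> s c x \<in> V"
  using finitely_spanned span_zero span_add span_scale by metis+

definition linear_on ::
  "('k::field \<Rightarrow> 'v::ab_group_add \<Rightarrow> 'v) \<Rightarrow> 'v set \<Rightarrow>
   ('k \<Rightarrow> 'w::ab_group_add \<Rightarrow> 'w) \<Rightarrow> 'w set \<Rightarrow> ('v \<Rightarrow> 'w) \<Rightarrow> bool" where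
  "linear_on s V t W f \<longleftrightarrow>
     (\<forall>x\<in>V. f x \<in> W) \<and>
     (\<forall>x\<in>V. \<forall>y\<in>V. f (x + y) = f x + f y) \<and>
     (\<forall>c. \<forall>x\<in>V. f (s c x) = t c (f x))"

definition bilinear_on ::
  "('k::field \<Rightarrow> 'u::ab_group_add \<Rightarrow> 'u) \<Rightarrow> 'u set \<Rightarrow>
   ('k \<Rightarrow> 'v::ab_group_add \<Rightarrow> 'v) \<Rightarrow> 'v set \<Rightarrow>
   ('k \<Rightarrow> 'w::ab_group_add \<Rightarrow> 'w) \<Rightarrow> 'w set \<Rightarrow> ('u \<Rightarrow> 'v \<Rightarrow> 'w) \<Rightarrow> bool" where
  "bilinear_on s U t V u W B \<longleftrightarrow>
     (\<forall>x\<in>U. linear_on t V u W (B x)) \<and> (\<forall>y\<in>V. linear_on s U u W (\<lambda>x. B x y))"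


section \<open>Duals\<close>

definition fscale :: "'k::field \<Rightarrow> ('a \<Rightarrow> 'k) \<Rightarrow> 'a \<Rightarrow> 'k" where
  "fscale c f = (\<lambda>x. c * f x)"

lemma vector_space_fscale: "vector_space fscale"
  by unfold_locales (auto simp: fscale_def fun_eq_iff algebra_simps)

text \<open>Functionals vanish off the carrier, so that equality of functionals is equality of functions.\<close>

definition dual :: "('k::field \<Rightarrow> 'v::ab_group_add \<Rightarrow> 'v) \<Rightarrow> 'v set \<Rightarrow> ('v \<Rightarrow> 'k) set" where
  "dual s V = {a. linear_on s V (*) UNIV a \<and> (\<forall>x. x \<notin> V \<longrightarrow> a x = 0)}"

definition dual_map :: "'v set \<Rightarrow> ('v \<Rightarrow> 'v) \<Rightarrow> ('v \<Rightarrow> 'k::field) \<Rightarrow> 'v \<Rightarrow> 'k" where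
  "dual_map V f a = (\<lambda>x. if x \<in> V then a (f x) else 0)"

definition ad_star ::
  "'v set \<Rightarrow> ('v \<Rightarrow> 'v \<Rightarrow> 'v) \<Rightarrow> 'v \<Rightarrow> ('v \<Rightarrow> 'k::field) \<Rightarrow> 'v \<Rightarrow> 'k" where
  "ad_star V br x b = (\<lambda>y. if y \<in> V then - b (br x y) else 0)"


section \<open>Tensor powers\<close>

text \<open>
  \<open>V \<otimes> V\<close> is realised as the span of the pure tensors \<open>x \<otimes> y\<close>, where \<open>x \<otimes> y\<close> is the bilinear form
  \<open>(a, b) \<mapsto> \<langle>a, x\<rangle> \<langle>b, y\<rangle>\<close> on the dual of \<open>V\<close>; thus \<open>T (a, b)\<close> is the pairing \<open>\<langle>a \<otimes> b, T\<rangle>\<close>.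
  The forms vanish when an argument is not in the dual.
  The universal property is \<open>tensor_universal\<close> below.
  The third tensor power is treated in the same way, by trilinear forms.
\<close>

definition pure_tensor ::
  "('k::field \<Rightarrow> 'v::ab_group_add \<Rightarrow> 'v) \<Rightarrow> 'v set \<Rightarrow> 'v \<Rightarrow> 'v \<Rightarrow> ('v \<Rightarrow> 'k) \<times> ('v \<Rightarrow> 'k) \<Rightarrow> 'k" where
  "pure_tensor s V x y =
     (\<lambda>(a, b). if a \<in> dual s V \<and> b \<in> dual s V then a x * b y else 0)"

definition tensor ::
  "('k::field \<Rightarrow> 'v::ab_group_add \<Rightarrow> 'v) \<Rightarrow> 'v set \<Rightarrow> (('v \<Rightarrow> 'k) \<times> ('v \<Rightarrow> 'k) \<Rightarrow> 'k) set" where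
  "tensor s V = module.span fscale {pure_tensor s V x y | x y. x \<in> V \<and> y \<in> V}"

definition pure_tensor3 ::
  "('k::field \<Rightarrow> 'v::ab_group_add \<Rightarrow> 'v) \<Rightarrow> 'v set \<Rightarrow> 'v \<Rightarrow> 'v \<Rightarrow> 'v \<Rightarrow>
   ('v \<Rightarrow> 'k) \<times> ('v \<Rightarrow> 'k) \<times> ('v \<Rightarrow> 'k) \<Rightarrow> 'k" where
  "pure_tensor3 s V x y z =
     (\<lambda>(a, b, c). if a \<in> dual s V \<and> b \<in> dual s V \<and> c \<in> dual s V then a x * b y * c z else 0)"

text \<open>\<open>f \<otimes> g\<close> is given by \<open>\<langle>a \<otimes> b, (f \<otimes> g) T\<rangle> = \<langle>f\<^sup>* a \<otimes> g\<^sup>* b, T\<rangle>\<close>, and similarly for three factors.\<close>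

definition tensor_map ::
  "('k::field \<Rightarrow> 'v::ab_group_add \<Rightarrow> 'v) \<Rightarrow> 'v set \<Rightarrow> ('v \<Rightarrow> 'v) \<Rightarrow> ('v \<Rightarrow> 'v) \<Rightarrow>
   (('v \<Rightarrow> 'k) \<times> ('v \<Rightarrow> 'k) \<Rightarrow> 'k) \<Rightarrow> ('v \<Rightarrow> 'k) \<times> ('v \<Rightarrow> 'k) \<Rightarrow> 'k" where
  "tensor_map s V f g T =
     (\<lambda>(a, b). if a \<in> dual s V \<and> b \<in> dual s V then T (dual_map V f a, dual_map V g b) else 0)"

definition tensor_map3 ::
  "('k::field \<Rightarrow> 'v::ab_group_add \<Rightarrow> 'v) \<Rightarrow> 'v set \<Rightarrow> ('v \<Rightarrow> 'v) \<Rightarrow> ('v \<Rightarrow> 'v) \<Rightarrow> ('v \<Rightarrow> 'v) \<Rightarrow>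
   (('v \<Rightarrow> 'k) \<times> ('v \<Rightarrow> 'k) \<times> ('v \<Rightarrow> 'k) \<Rightarrow> 'k) \<Rightarrow> ('v \<Rightarrow> 'k) \<times> ('v \<Rightarrow> 'k) \<times> ('v \<Rightarrow> 'k) \<Rightarrow> 'k" where
  "tensor_map3 s V f g h T =
     (\<lambda>(a, b, c). if a \<in> dual s V \<and> b \<in> dual s V \<and> c \<in> dual s V
        then T (dual_map V f a, dual_map V g b, dual_map V h c) else 0)"

definition flip :: "('a \<times> 'a \<Rightarrow> 'k) \<Rightarrow> 'a \<times> 'a \<Rightarrow> 'k" where
  "flip T = (\<lambda>(a, b). T (b, a))"

text \<open>\<open>flip12\<close> is \<open>\<tau> \<otimes> id\<close> and \<open>flip23\<close> is \<open>id \<otimes> \<tau>\<close>.\<close>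

definition flip12 :: "('a \<times> 'a \<times> 'a \<Rightarrow> 'k) \<Rightarrow> 'a \<times> 'a \<times> 'a \<Rightarrow> 'k" where
  "flip12 T = (\<lambda>(a, b, c). T (b, a, c))"

definition flip23 :: "('a \<times> 'a \<times> 'a \<Rightarrow> 'k) \<Rightarrow> 'a \<times> 'a \<times> 'a \<Rightarrow> 'k" where
  "flip23 T = (\<lambda>(a, b, c). T (a, c, b))"

text \<open>
  \<open>dual_bracket V \<Delta> a b\<close> is \<open>\<Delta>\<^sup>*(a \<otimes> b)\<close>, and \<open>tensor_cobracket s V f \<Delta>\<close> is
  \<open>f \<otimes> \<Delta> : V \<otimes> V \<rightarrow> V \<otimes> V \<otimes> V\<close>.
\<close>

definition dual_bracket ::
  "'v set \<Rightarrow> ('v \<Rightarrow> ('v \<Rightarrow> 'k::field) \<times> ('v \<Rightarrow> 'k) \<Rightarrow> 'k) \<Rightarrow> ('v \<Rightarrow> 'k) \<Rightarrow> ('v \<Rightarrow> 'k) \<Rightarrow> 'v \<Rightarrow> 'k" where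
  "dual_bracket V \<Delta> a b = (\<lambda>x. if x \<in> V then \<Delta> x (a, b) else 0)"

definition tensor_cobracket ::
  "('k::field \<Rightarrow> 'v::ab_group_add \<Rightarrow> 'v) \<Rightarrow> 'v set \<Rightarrow> ('v \<Rightarrow> 'v) \<Rightarrow>
   ('v \<Rightarrow> ('v \<Rightarrow> 'k) \<times> ('v \<Rightarrow> 'k) \<Rightarrow> 'k) \<Rightarrow>
   (('v \<Rightarrow> 'k) \<times> ('v \<Rightarrow> 'k) \<Rightarrow> 'k) \<Rightarrow> ('v \<Rightarrow> 'k) \<times> ('v \<Rightarrow> 'k) \<times> ('v \<Rightarrow> 'k) \<Rightarrow> 'k" where
  "tensor_cobracket s V f \<Delta> T =
     (\<lambda>(a, b, c). if a \<in> dual s V \<and> b \<in> dual s V \<and> c \<in> dual s V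
        then T (dual_map V f a, dual_bracket V \<Delta> b c) else 0)"


subsection \<open>The model has the expected properties\<close>

lemma dual_iff:
  "a \<in> dual s V \<longleftrightarrow> (\<forall>x\<in>V. \<forall>y\<in>V. a (x + y) = a x + a y) \<and>
     (\<forall>c. \<forall>x\<in>V. a (s c x) = c * a x) \<and> (\<forall>x. x \<notin> V \<longrightarrow> a x = 0)"
  by (simp add: dual_def linear_on_def)

lemma dual_map_in_dual:
  assumes "fd_space s V" "linear_on s V s V f" "a \<in> dual s V"
  shows "dual_map V f a \<in> dual s V"
proof -
  interpret fd_space s V by fact
  show ?thesis
    using assms(2,3)
    by (simp add: dual_iff dual_map_def linear_on_def carrier_add carrier_scale)
qed

lemma tensor_map_pure:
  assumes "fd_space s V" "linear_on s V s V f" "linear_on s V s V g" "x \<in> V" "y \<in> V"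
  shows "tensor_map s V f g (pure_tensor s V x y) = pure_tensor s V (f x) (g y)"
  using assms dual_map_in_dual[OF assms(1,2)] dual_map_in_dual[OF assms(1,3)]
  by (auto simp: tensor_map_def pure_tensor_def fun_eq_iff dual_map_def)

lemma tensor_map3_pure:
  assumes "fd_space s V" "linear_on s V s V f" "linear_on s V s V g" "linear_on s V s V h"
    "x \<in> V" "y \<in> V" "z \<in> V"
  shows "tensor_map3 s V f g h (pure_tensor3 s V x y z) = pure_tensor3 s V (f x) (g y) (h z)"
  using assms dual_map_in_dual[OF assms(1,2)] dual_map_in_dual[OF assms(1,3)]
    dual_map_in_dual[OF assms(1,4)]
  by (auto simp: tensor_map3_def pure_tensor3_def fun_eq_iff dual_map_def)

lemma flip_pure: "flip (pure_tensor s V x y) = pure_tensor s V y x"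
  by (auto simp: flip_def pure_tensor_def fun_eq_iff)

lemma flip12_pure: "flip12 (pure_tensor3 s V x y z) = pure_tensor3 s V y x z"
  by (auto simp: flip12_def pure_tensor3_def fun_eq_iff)

lemma flip23_pure: "flip23 (pure_tensor3 s V x y z) = pure_tensor3 s V x z y"
  by (auto simp: flip23_def pure_tensor3_def fun_eq_iff)

lemma tensor_bilinear:
  assumes "fd_space s V" "T \<in> tensor s V"
  shows "bilinear_on fscale (dual s V) fscale (dual s V) (*) UNIV (\<lambda>a b. T (a, b))"
    and "a \<notin> dual s V \<or> b \<notin> dual s V \<Longrightarrow> T (a, b) = 0"
proof -
  interpret fd_space s V by fact
  interpret F: vector_space "fscale :: 'a \<Rightarrow> (('b \<Rightarrow> 'a) \<times> ('b \<Rightarrow> 'a) \<Rightarrow> 'a) \<Rightarrow> _"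
    by (rule vector_space_fscale)
  have dual_add: "a + b \<in> dual s V" if "a \<in> dual s V" "b \<in> dual s V" for a b
    using that by (simp add: dual_iff algebra_simps)
  have dual_scale: "fscale c a \<in> dual s V" if "a \<in> dual s V" for a c
    using that by (simp add: dual_iff fscale_def algebra_simps)
  have "bilinear_on fscale (dual s V) fscale (dual s V) (*) UNIV (\<lambda>a b. T (a, b)) \<and>
        (\<forall>a b. a \<notin> dual s V \<or> b \<notin> dual s V \<longrightarrow> T (a, b) = 0)"
    using assms(2) unfolding tensor_def
  proof (induction rule: F.span_induct_alt)
    case base
    show ?case by (auto simp: bilinear_on_def linear_on_def)
  next
    case (step c x y)
    then obtain u v where x: "x = pure_tensor s V u v" by blast
    have eq: "(fscale c x + y) (a, b) = (if a \<in> dual s V \<and> b \<in> dual s V then c * (a u * b v) else 0) + y (a, b)" for a b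
      by (simp add: x pure_tensor_def fscale_def)
    show ?case
      using step(2) unfolding eq
      by (simp add: bilinear_on_def linear_on_def dual_add dual_scale)
         (simp add: fscale_def algebra_simps)
  qed
  then show "bilinear_on fscale (dual s V) fscale (dual s V) (*) UNIV (\<lambda>a b. T (a, b))"
    and "a \<notin> dual s V \<or> b \<notin> dual s V \<Longrightarrow> T (a, b) = 0"
    by auto
qed

lemma tensor_cobracket_pure:
  assumes "fd_space s V" "linear_on s V s V f" "linear_on s V fscale (tensor s V) \<Delta>"
    "x \<in> V" "y \<in> V" "\<Delta> y = (\<Sum>i\<in>I. pure_tensor s V (u i) (v i))"
  shows "tensor_cobracket s V f \<Delta> (pure_tensor s V x y) =
         (\<Sum>i\<in>I. pure_tensor3 s V (f x) (u i) (v i))"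
proof -
  have sum_app: "(\<Sum>i\<in>I. g i) z = (\<Sum>i\<in>I. g i z)" for g :: "_ \<Rightarrow> _ \<Rightarrow> 'a" and z
    by (induction I rule: infinite_finite_induct) auto
  interpret fd_space s V by fact
  have db: "dual_bracket V \<Delta> b c \<in> dual s V" for b c
    using assms(3)
    by (simp add: dual_bracket_def dual_iff linear_on_def fscale_def carrier_add carrier_scale)
  have dm: "dual_map V f a \<in> dual s V" if "a \<in> dual s V" for a
    using dual_map_in_dual[OF assms(1,2) that] .
  have dm_app: "dual_map V f a x = a (f x)" for a :: "'b \<Rightarrow> 'a"
    using assms(4) by (simp add: dual_map_def)
  have db_app: "dual_bracket V \<Delta> b c y = \<Delta> y (b, c)" for b c
    using assms(5) by (simp add: dual_bracket_def)
  have "tensor_cobracket s V f \<Delta> (pure_tensor s V x y) (a, b, c) =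
        (\<Sum>i\<in>I. pure_tensor3 s V (f x) (u i) (v i) (a, b, c))" for a b c
  proof (cases "a \<in> dual s V \<and> b \<in> dual s V \<and> c \<in> dual s V")
    case True
    then show ?thesis
      using assms(4,5)
      by (simp add: tensor_cobracket_def pure_tensor_def pure_tensor3_def db dm
          dm_app db_app assms(6) sum_app sum_distrib_left mult.assoc)
  next
    case False
    then show ?thesis by (auto simp: tensor_cobracket_def pure_tensor3_def)
  qed
  then show ?thesis by (auto simp: fun_eq_iff sum_app)
qed

theorem tensor_universal:
  fixes B :: "'v::ab_group_add \<Rightarrow> 'v \<Rightarrow> 'w::ab_group_add"
    and s :: "'k::field \<Rightarrow> 'v \<Rightarrow> 'v" and t :: "'k \<Rightarrow> 'w \<Rightarrow> 'w"
  assumes "fd_space s V" "vector_space t" "bilinear_on s V s V t UNIV B"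
  shows "bilinear_on s V s V fscale (tensor s V) (pure_tensor s V)"
    and "\<exists>h. linear_on fscale (tensor s V) t UNIV h \<and>
           (\<forall>x\<in>V. \<forall>y\<in>V. h (pure_tensor s V x y) = B x y)"
    and "\<lbrakk>linear_on fscale (tensor s V) t UNIV h; linear_on fscale (tensor s V) t UNIV h';
          \<forall>x\<in>V. \<forall>y\<in>V. h (pure_tensor s V x y) = B x y;
          \<forall>x\<in>V. \<forall>y\<in>V. h' (pure_tensor s V x y) = B x y; T \<in> tensor s V\<rbrakk> \<Longrightarrow> h T = h' T"
proof -
  interpret fd_space s V by fact
  interpret W: vector_space t by fact
  interpret F: vector_space "fscale :: 'k \<Rightarrow> (('v \<Rightarrow> 'k) \<times> ('v \<Rightarrow> 'k) \<Rightarrow> 'k) \<Rightarrow> _"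
    by (rule vector_space_fscale)
  have pure: "pure_tensor s V x y \<in> tensor s V" if "x \<in> V" "y \<in> V" for x y
    unfolding tensor_def using that by (auto intro: F.span_base)
  show "bilinear_on s V s V fscale (tensor s V) (pure_tensor s V)"
  proof -
    have dual_add: "a (x + y) = a x + a y" if "a \<in> dual s V" "x \<in> V" "y \<in> V" for a x y
      using that by (simp add: dual_iff)
    have dual_scale: "a (s c x) = c * a x" if "a \<in> dual s V" "x \<in> V" for a c x
      using that by (simp add: dual_iff)
    have "pure_tensor s V (x + y) z (a, b) = pure_tensor s V x z (a, b) + pure_tensor s V y z (a, b)"
      "pure_tensor s V z (x + y) (a, b) = pure_tensor s V z x (a, b) + pure_tensor s V z y (a, b)"
      "pure_tensor s V (s c x) z (a, b) = c * pure_tensor s V x z (a, b)"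
      "pure_tensor s V z (s c x) (a, b) = c * pure_tensor s V z x (a, b)"
      if "x \<in> V" "y \<in> V" for x y z a b c
      using that dual_add[of a x y] dual_add[of b x y] dual_scale[of a x c] dual_scale[of b x c]
      by (simp_all add: pure_tensor_def algebra_simps)
    then show ?thesis
      using pure by (simp add: bilinear_on_def linear_on_def fun_eq_iff fscale_def)
  qed
  obtain C where C: "finite C" "V = span C" using finitely_spanned by blast
  obtain E where E: "E \<subseteq> V" "independent E" "V \<subseteq> span E"
    using basis_exists[of V] by metis
  have finE: "finite E"
    using independent_span_bound[OF C(1) E(2)] E(1) C(2) by simp
  have VE: "V = span E"
    using E(1,3) span_mono[of E "span C"] span_span[of C] C(2) by auto
  define e where "e = (\<lambda>i x. representation E x i)"
  have e_dual: "e i \<in> dual s V" for i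
    using E VE
    by (simp add: dual_iff e_def representation_add representation_scale)
       (simp add: representation_def)
  have expand: "(\<Sum>i\<in>E. s (e i x) i) = x" if "x \<in> V" for x
    unfolding e_def using sum_representation_eq[OF E(2) _ finE, of x] that VE by simp
  have Bl: "linear_on s V t UNIV (B x)" if "x \<in> V" for x
    using assms(3) that by (simp add: bilinear_on_def)
  have Br: "linear_on s V t UNIV (\<lambda>x. B x y)" if "y \<in> V" for y
    using assms(3) that by (simp add: bilinear_on_def)
  have lin_sum: "f (\<Sum>i\<in>I. s (c i) (i)) = (\<Sum>i\<in>I. t (c i) (f i))"
    if "linear_on s V t UNIV f" "I \<subseteq> V" "finite I" for f c I
    using that(3,2)
  proof (induction I)
    case empty
    have "f (s 0 0) = t 0 (f 0)" using that(1) carrier_zero unfolding linear_on_def by blast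
    then show ?case by simp
  next
    case (insert i I)
    have IV: "(\<Sum>i\<in>I. s (c i) i) \<in> V"
      unfolding C(2) using insert.prems C(2) by (intro span_sum span_scale) auto
    have iV: "i \<in> V" using insert.prems by simp
    have "f (s (c i) i + (\<Sum>i\<in>I. s (c i) i)) = f (s (c i) i) + f (\<Sum>i\<in>I. s (c i) i)"
      using that(1) IV carrier_scale[OF iV] unfolding linear_on_def by blast
    moreover have "f (s (c i) i) = t (c i) (f i)"
      using that(1) iV unfolding linear_on_def by blast
    ultimately show ?case using insert by simp
  qed
  define h where "h T = (\<Sum>i\<in>E. \<Sum>j\<in>E. t (T (e i, e j)) (B i j))" for T
  have "linear_on fscale (tensor s V) t UNIV h"
    by (auto simp: linear_on_def h_def fscale_def W.scale_left_distrib sum.distrib W.scale_sum_right)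
  moreover have "h (pure_tensor s V x y) = B x y" if "x \<in> V" "y \<in> V" for x y
  proof -
    have "B x y = B (\<Sum>i\<in>E. s (e i x) i) y" using expand that by simp
    also have "\<dots> = (\<Sum>i\<in>E. t (e i x) (B i y))"
      using lin_sum[OF Br[OF that(2)] E(1) finE] .
    also have "\<dots> = (\<Sum>i\<in>E. t (e i x) (\<Sum>j\<in>E. t (e j y) (B i j)))"
    proof (rule sum.cong[OF refl])
      fix i assume "i \<in> E"
      then show "t (e i x) (B i y) = t (e i x) (\<Sum>j\<in>E. t (e j y) (B i j))"
        using lin_sum[OF Bl E(1) finE, of i "\<lambda>j. e j y"] expand[OF that(2)] E(1) by auto
    qed
    also have "\<dots> = h (pure_tensor s V x y)"
      by (simp add: h_def pure_tensor_def e_dual W.scale_sum_right)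
    finally show ?thesis by simp
  qed
  ultimately show "\<exists>h. linear_on fscale (tensor s V) t UNIV h \<and>
           (\<forall>x\<in>V. \<forall>y\<in>V. h (pure_tensor s V x y) = B x y)" by blast
  show "h T = h' T"
    if h: "linear_on fscale (tensor s V) t UNIV h" and h': "linear_on fscale (tensor s V) t UNIV h'"
      and eq: "\<forall>x\<in>V. \<forall>y\<in>V. h (pure_tensor s V x y) = B x y"
        "\<forall>x\<in>V. \<forall>y\<in>V. h' (pure_tensor s V x y) = B x y" and T: "T \<in> tensor s V" for h h' T
  proof -
    have add: "g (x + y) = g x + g y" and scale: "g (fscale c x) = t c (g x)"
      if "linear_on fscale (tensor s V) t UNIV g" "x \<in> tensor s V" "y \<in> tensor s V" for g c x y
      using that unfolding linear_on_def by blast+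
    have T_zero: "0 \<in> tensor s V"
      unfolding tensor_def by (rule F.span_zero)
    have T_add: "x + y \<in> tensor s V" if "x \<in> tensor s V" "y \<in> tensor s V" for x y
      using that unfolding tensor_def by (rule F.span_add)
    have T_scale: "fscale c x \<in> tensor s V" if "x \<in> tensor s V" for c x
      using that unfolding tensor_def by (rule F.span_scale)
    have "T \<in> tensor s V \<and> h T = h' T"
      using T[unfolded tensor_def]
    proof (induction rule: F.span_induct_alt)
      case base
      show ?case
        using scale[OF h T_zero T_zero, of 0] scale[OF h' T_zero T_zero, of 0] T_zero
        by (simp add: zero_fun_def)
    next
      case (step c x y)
      then obtain u v where x: "x = pure_tensor s V u v" and uv: "u \<in> V" "v \<in> V" by blast
      have xT: "x \<in> tensor s V" and yT: "y \<in> tensor s V" using pure[OF uv] step x by auto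
      have hx: "h x = h' x" using eq uv x by simp
      show ?case
        using add[OF h T_scale[OF xT] yT, of c] add[OF h' T_scale[OF xT] yT, of c]
          scale[OF h xT xT, of c] scale[OF h' xT xT, of c] hx step(2) T_add[OF T_scale[OF xT] yT]
        by (simp add: plus_fun_def)
    qed
    then show ?thesis by simp
  qed
qed


section \<open>BiHom-Lie algebras and their representations\<close>

locale bihom_lie_algebra = fd_space s L
  for s :: "'k::field \<Rightarrow> 'v::ab_group_add \<Rightarrow> 'v" and L :: "'v set" +
  fixes br :: "'v \<Rightarrow> 'v \<Rightarrow> 'v" and \<alpha> \<beta> :: "'v \<Rightarrow> 'v"
  assumes bilinear_bracket: "bilinear_on s L s L s L br"
    and linear_alpha: "linear_on s L s L \<alpha>"
    and linear_beta: "linear_on s L s L \<beta>"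
    and alpha_beta: "x \<in> L \<Longrightarrow> \<alpha> (\<beta> x) = \<beta> (\<alpha> x)"
    and alpha_bracket: "\<lbrakk>x \<in> L; y \<in> L\<rbrakk> \<Longrightarrow> \<alpha> (br x y) = br (\<alpha> x) (\<alpha> y)"
    and beta_bracket: "\<lbrakk>x \<in> L; y \<in> L\<rbrakk> \<Longrightarrow> \<beta> (br x y) = br (\<beta> x) (\<beta> y)"
    and bihom_skew: "\<lbrakk>x \<in> L; y \<in> L\<rbrakk> \<Longrightarrow> br (\<beta> x) (\<alpha> y) = - br (\<beta> y) (\<alpha> x)"
    and bihom_jacobi: "\<lbrakk>x \<in> L; y \<in> L; z \<in> L\<rbrakk> \<Longrightarrow>
      br (\<beta> (\<beta> x)) (br (\<beta> y) (\<alpha> z)) + br (\<beta> (\<beta> y)) (br (\<beta> z) (\<alpha> x))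
        + br (\<beta> (\<beta> z)) (br (\<beta> x) (\<alpha> y)) = 0"

locale nijenhuis_bihom_lie_algebra = bihom_lie_algebra s L br \<alpha> \<beta>
  for s :: "'k::field \<Rightarrow> 'v::ab_group_add \<Rightarrow> 'v" and L :: "'v set"
    and br :: "'v \<Rightarrow> 'v \<Rightarrow> 'v" and N \<alpha> \<beta> :: "'v \<Rightarrow> 'v" +
  assumes linear_N: "linear_on s L s L N"
    and N_alpha: "x \<in> L \<Longrightarrow> N (\<alpha> x) = \<alpha> (N x)"
    and N_beta: "x \<in> L \<Longrightarrow> N (\<beta> x) = \<beta> (N x)"
    and nijenhuis: "\<lbrakk>x \<in> L; y \<in> L\<rbrakk> \<Longrightarrow>
      br (N x) (N y) = N (br (N x) y + br x (N y)) - N (N (br x y))"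

locale involutive_nijenhuis_bihom_lie_algebra = nijenhuis_bihom_lie_algebra s L br N \<alpha> \<beta>
  for s :: "'k::field \<Rightarrow> 'v::ab_group_add \<Rightarrow> 'v" and L :: "'v set"
    and br :: "'v \<Rightarrow> 'v \<Rightarrow> 'v" and N \<alpha> \<beta> :: "'v \<Rightarrow> 'v" +
  assumes alpha_involutive: "x \<in> L \<Longrightarrow> \<alpha> (\<alpha> x) = x"
    and beta_involutive: "x \<in> L \<Longrightarrow> \<beta> (\<beta> x) = x"

text \<open>Bilinearity of \<open>\<rho>\<close> says that \<open>\<rho>\<close> is a linear map into the endomorphisms of \<open>V\<close>.\<close>

locale bihom_lie_representation = bihom_lie_algebra s L br \<alpha> \<beta> + M: fd_space t V
  for s :: "'k::field \<Rightarrow> 'v::ab_group_add \<Rightarrow> 'v" and L :: "'v set"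
    and br :: "'v \<Rightarrow> 'v \<Rightarrow> 'v" and \<alpha> \<beta> :: "'v \<Rightarrow> 'v"
    and t :: "'k \<Rightarrow> 'w::ab_group_add \<Rightarrow> 'w" and V :: "'w set" +
  fixes \<rho> :: "'v \<Rightarrow> 'w \<Rightarrow> 'w" and p q :: "'w \<Rightarrow> 'w"
  assumes linear_rho: "bilinear_on s L t V t V \<rho>"
    and linear_p: "linear_on t V t V p"
    and linear_q: "linear_on t V t V q"
    and p_q: "v \<in> V \<Longrightarrow> p (q v) = q (p v)"
    and p_rho: "\<lbrakk>x \<in> L; v \<in> V\<rbrakk> \<Longrightarrow> p (\<rho> x v) = \<rho> (\<alpha> x) (p v)"
    and q_rho: "\<lbrakk>x \<in> L; v \<in> V\<rbrakk> \<Longrightarrow> q (\<rho> x v) = \<rho> (\<beta> x) (q v)"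
    and rho_bracket: "\<lbrakk>x \<in> L; y \<in> L; v \<in> V\<rbrakk> \<Longrightarrow>
      \<rho> (br (\<beta> x) y) (q v) = \<rho> (\<alpha> (\<beta> x)) (\<rho> y v) - \<rho> (\<beta> y) (\<rho> (\<alpha> x) v)"

locale nijenhuis_bihom_lie_representation =
  nijenhuis_bihom_lie_algebra s L br N \<alpha> \<beta> + bihom_lie_representation s L br \<alpha> \<beta> t V \<rho> p q
  for s :: "'k::field \<Rightarrow> 'v::ab_group_add \<Rightarrow> 'v" and L :: "'v set"
    and br :: "'v \<Rightarrow> 'v \<Rightarrow> 'v" and N \<alpha> \<beta> :: "'v \<Rightarrow> 'v"
    and t :: "'k \<Rightarrow> 'w::ab_group_add \<Rightarrow> 'w" and V :: "'w set"
    and \<rho> :: "'v \<Rightarrow> 'w \<Rightarrow> 'w" and \<eta> p q :: "'w \<Rightarrow> 'w" +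
  assumes linear_eta: "linear_on t V t V \<eta>"
    and eta_p: "v \<in> V \<Longrightarrow> \<eta> (p v) = p (\<eta> v)"
    and eta_q: "v \<in> V \<Longrightarrow> \<eta> (q v) = q (\<eta> v)"
    and nijenhuis_rho: "\<lbrakk>x \<in> L; v \<in> V\<rbrakk> \<Longrightarrow>
      \<rho> (N x) (\<eta> v) = \<eta> (\<rho> (N x) v) + \<eta> (\<rho> x (\<eta> v)) - \<eta> (\<eta> (\<rho> x v))"

text \<open>
  That the algebra is an involutive Nijenhuis BiHom-Lie algebra is part of the definition.
\<close>

locale adjoint_admissible = involutive_nijenhuis_bihom_lie_algebra s L br N \<alpha> \<beta>
  for s :: "'k::field \<Rightarrow> 'v::ab_group_add \<Rightarrow> 'v" and L :: "'v set"
    and br :: "'v \<Rightarrow> 'v \<Rightarrow> 'v" and N \<alpha> \<beta> :: "'v \<Rightarrow> 'v" +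
  fixes S :: "'v \<Rightarrow> 'v"
  assumes linear_S: "linear_on s L s L S"
    and dual_representation:
      "nijenhuis_bihom_lie_representation s L br N \<alpha> \<beta> fscale (dual s L)
         (ad_star L br) (dual_map L S) (dual_map L \<alpha>) (dual_map L \<beta>)"
    and admissible: "\<lbrakk>x \<in> L; y \<in> L\<rbrakk> \<Longrightarrow>
      S (br (N x) y) + br x (S (S y)) = br (N x) (S y) + S (br x (S y))"


section \<open>BiHom-Lie coalgebras and bialgebras\<close>

definition co_jacobiator ::
  "('k::field \<Rightarrow> 'v::ab_group_add \<Rightarrow> 'v) \<Rightarrow> 'v set \<Rightarrow>
   ('v \<Rightarrow> ('v \<Rightarrow> 'k) \<times> ('v \<Rightarrow> 'k) \<Rightarrow> 'k) \<Rightarrow> ('v \<Rightarrow> 'v) \<Rightarrow> ('v \<Rightarrow> 'v) \<Rightarrow>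
   'v \<Rightarrow> ('v \<Rightarrow> 'k) \<times> ('v \<Rightarrow> 'k) \<times> ('v \<Rightarrow> 'k) \<Rightarrow> 'k" where
  "co_jacobiator s L \<Delta> \<alpha> \<beta> x =
     tensor_map3 s L id \<beta> \<alpha> (tensor_cobracket s L (\<beta> \<circ> \<beta>) \<Delta> (\<Delta> x))"

locale bihom_lie_coalgebra = fd_space s L
  for s :: "'k::field \<Rightarrow> 'v::ab_group_add \<Rightarrow> 'v" and L :: "'v set" +
  fixes \<Delta> :: "'v \<Rightarrow> ('v \<Rightarrow> 'k) \<times> ('v \<Rightarrow> 'k) \<Rightarrow> 'k" and \<alpha> \<beta> :: "'v \<Rightarrow> 'v"
  assumes linear_cobracket: "linear_on s L fscale (tensor s L) \<Delta>"
    and co_linear_alpha: "linear_on s L s L \<alpha>"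
    and co_linear_beta: "linear_on s L s L \<beta>"
    and co_alpha_beta: "x \<in> L \<Longrightarrow> \<alpha> (\<beta> x) = \<beta> (\<alpha> x)"
    and cobracket_alpha: "x \<in> L \<Longrightarrow> \<Delta> (\<alpha> x) = tensor_map s L \<alpha> \<alpha> (\<Delta> x)"
    and cobracket_beta: "x \<in> L \<Longrightarrow> \<Delta> (\<beta> x) = tensor_map s L \<beta> \<beta> (\<Delta> x)"
    and co_skew: "x \<in> L \<Longrightarrow>
      tensor_map s L \<beta> \<alpha> (\<Delta> x) + flip (tensor_map s L \<beta> \<alpha> (\<Delta> x)) = 0"
    and co_jacobi: "x \<in> L \<Longrightarrow>
      co_jacobiator s L \<Delta> \<alpha> \<beta> x + flip12 (flip23 (co_jacobiator s L \<Delta> \<alpha> \<beta> x))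
        + flip23 (flip12 (co_jacobiator s L \<Delta> \<alpha> \<beta> x)) = 0"

locale nijenhuis_bihom_lie_coalgebra = bihom_lie_coalgebra s L \<Delta> \<alpha> \<beta>
  for s :: "'k::field \<Rightarrow> 'v::ab_group_add \<Rightarrow> 'v" and L :: "'v set"
    and \<Delta> :: "'v \<Rightarrow> ('v \<Rightarrow> 'k) \<times> ('v \<Rightarrow> 'k) \<Rightarrow> 'k" and S \<alpha> \<beta> :: "'v \<Rightarrow> 'v" +
  assumes co_linear_S: "linear_on s L s L S"
    and co_nijenhuis: "x \<in> L \<Longrightarrow>
      tensor_map s L S S (\<Delta> x) + \<Delta> (S (S x)) =
      tensor_map s L S id (\<Delta> (S x)) + tensor_map s L id S (\<Delta> (S x))"

locale bihom_lie_bialgebra = bihom_lie_algebra s L br \<alpha> \<beta> + bihom_lie_coalgebra s L \<Delta> \<alpha> \<beta>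
  for s :: "'k::field \<Rightarrow> 'v::ab_group_add \<Rightarrow> 'v" and L :: "'v set"
    and br :: "'v \<Rightarrow> 'v \<Rightarrow> 'v" and \<Delta> :: "'v \<Rightarrow> ('v \<Rightarrow> 'k) \<times> ('v \<Rightarrow> 'k) \<Rightarrow> 'k"
    and \<alpha> \<beta> :: "'v \<Rightarrow> 'v" +
  assumes alpha_invertible: "bij_betw \<alpha> L L"
    and compatibility: "\<lbrakk>x \<in> L; y \<in> L\<rbrakk> \<Longrightarrow>
      \<Delta> (br (inv_into L \<alpha> (\<beta> x)) y) =
        (tensor_map s L (br (\<beta> x)) \<beta> (\<Delta> y)
          + tensor_map s L \<beta> (br (inv_into L \<alpha> (\<beta> (\<beta> x)))) (\<Delta> y))
      - (tensor_map s L (br (\<beta> y)) \<beta> (\<Delta> x)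
          + tensor_map s L \<beta> (br (inv_into L \<alpha> (\<beta> (\<beta> y)))) (\<Delta> x))"

locale nijenhuis_bihom_lie_bialgebra =
  fixes s :: "'k::field \<Rightarrow> 'v::ab_group_add \<Rightarrow> 'v" and L :: "'v set"
    and br :: "'v \<Rightarrow> 'v \<Rightarrow> 'v" and N :: "'v \<Rightarrow> 'v"
    and \<Delta> :: "'v \<Rightarrow> ('v \<Rightarrow> 'k) \<times> ('v \<Rightarrow> 'k) \<Rightarrow> 'k" and S \<alpha> \<beta> :: "'v \<Rightarrow> 'v"
  assumes bialgebra: "bihom_lie_bialgebra s L br \<Delta> \<alpha> \<beta>"
    and nijenhuis_algebra: "involutive_nijenhuis_bihom_lie_algebra s L br N \<alpha> \<beta>"
    and nijenhuis_coalgebra: "nijenhuis_bihom_lie_coalgebra s L \<Delta> S \<alpha> \<beta>"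
    and S_admissible: "adjoint_admissible s L br N \<alpha> \<beta> S"
    and N_admissible: "adjoint_admissible fscale (dual s L) (dual_bracket L \<Delta>)
      (dual_map L S) (dual_map L \<alpha>) (dual_map L \<beta>) (dual_map L N)"

definition coboundary ::
  "('k::field \<Rightarrow> 'v::ab_group_add \<Rightarrow> 'v) \<Rightarrow> 'v set \<Rightarrow> ('v \<Rightarrow> 'v \<Rightarrow> 'v) \<Rightarrow> ('v \<Rightarrow> 'v) \<Rightarrow> ('v \<Rightarrow> 'v) \<Rightarrow>
   (('v \<Rightarrow> 'k) \<times> ('v \<Rightarrow> 'k) \<Rightarrow> 'k) \<Rightarrow> 'v \<Rightarrow> ('v \<Rightarrow> 'k) \<times> ('v \<Rightarrow> 'k) \<Rightarrow> 'k" where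
  "coboundary s L br \<alpha> \<beta> r x =
     tensor_map s L (br x) \<beta> r + tensor_map s L \<beta> (br (inv_into L \<alpha> (\<beta> x))) r"

end

theory Submission
  imports Defs
begin

text \<open>
  Write \<open>A\<^sub>x\<close> for the transpose of \<open>[x, -]\<close> and, for functionals \<open>a\<close> and \<open>b\<close>, write
  \<open>r (a, b)\<close> for \<open>\<langle>a \<otimes> b, r\<rangle>\<close>. Since \<open>\<alpha>\<^sup>2 = id\<close>, the coboundary is
  \<open>\<Delta>\<^sub>r x (a, b) = r (A\<^sub>x a, \<beta>\<^sup>* b) + r (\<beta>\<^sup>* a, A\<^sub>y b)\<close> with \<open>y = \<alpha> (\<beta> x)\<close>.

  Two conditions have to be proved: the Nijenhuis identity for the coalgebra \<open>(\<Delta>\<^sub>r, S)\<close>, and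
  the admissibility of \<open>N\<^sup>*\<close> for the dual algebra.

  Admissibility asks for a representation on the dual, but in the involutive case this
  costs nothing (\<open>adjoint_admissibleI\<close>): the BiHom-Jacobi identity makes \<open>ad\<^sup>*\<close> a representation,
  and its compatibility with the Nijenhuis operator is the transpose of the remaining equation of
  admissibility. So, once the dual is known to be an involutive Nijenhuis BiHom-Lie algebra, only
  that one equation is left. Like the Nijenhuis identity, it is linear in \<open>\<Delta>\<^sub>r\<close> and can be tested
  on a pair \<open>(a, b)\<close>.

  For the two equations, the hypotheses on \<open>r\<close> say that \<open>r (S\<^sup>* a, b) = r (a, N\<^sup>* b)\<close> and, by
  skewness, \<open>r (a, S\<^sup>* b) = r (N\<^sup>* a, b)\<close> (\<open>r_move\<close>). With these rules, in the terms that come from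
  the first summand of \<open>\<Delta>\<^sub>r\<close> all copies of \<open>S\<^sup>*\<close> and \<open>N\<^sup>*\<close> can be moved to the first argument
  of \<open>r\<close>, so that the second is \<open>\<beta>\<^sup>* b\<close>; in the terms from the second summand they can be moved
  to the second argument, so that the first is \<open>\<beta>\<^sup>* a\<close>. The other argument is then a transposed
  identity of \<open>L\<close> (\<open>transposed_identities\<close>):
  \<^item> for the Nijenhuis identity of the coalgebra, both summands give the admissibility of \<open>S\<close> with
    the two bracket factors exchanged;
  \<^item> for the admissibility of \<open>N\<^sup>*\<close>, the first summand gives the admissibility of \<open>S\<close> and the
    second one the Nijenhuis identity of \<open>N\<close>.
\<close>

section \<open>The dual of a finite-dimensional space\<close>

lemma dual_map_apply: "x \<in> V \<Longrightarrow> dual_map V f a x = a (f x)"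
  by (simp add: dual_map_def)

lemma dual_bracket_apply: "x \<in> V \<Longrightarrow> dual_bracket V \<Delta> a b x = \<Delta> x (a, b)"
  by (simp add: dual_bracket_def)

lemma dual_zero: "0 \<in> dual s V"
  by (simp add: dual_iff)

lemma dual_add: "a \<in> dual s V \<Longrightarrow> b \<in> dual s V \<Longrightarrow> a + b \<in> dual s V"
  by (simp add: dual_iff algebra_simps)

lemma dual_scale: "a \<in> dual s V \<Longrightarrow> fscale c a \<in> dual s V"
  by (simp add: dual_iff fscale_def algebra_simps)

lemma dual_map_id: "a \<in> dual s V \<Longrightarrow> dual_map V id a = a"
  by (auto simp: dual_iff dual_map_def fun_eq_iff)

context fd_space
begin

lemma dual_apply_linear:
  assumes "a \<in> dual s V"
  shows "\<lbrakk>x \<in> V; y \<in> V\<rbrakk> \<Longrightarrow> a (x + y) = a x + a y"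
    and "x \<in> V \<Longrightarrow> a (s c x) = c * a x"
    and "x \<in> V \<Longrightarrow> a (- x) = - a x"
    and "\<lbrakk>x \<in> V; y \<in> V\<rbrakk> \<Longrightarrow> a (x - y) = a x - a y"
proof -
  show add: "a (x + y) = a x + a y" if "x \<in> V" "y \<in> V" for x y
    using assms that by (simp add: dual_iff)
  have scale: "a (s c x) = c * a x" if "x \<in> V" for c x
    using assms that by (simp add: dual_iff)
  then show "x \<in> V \<Longrightarrow> a (s c x) = c * a x" .
  show neg: "a (- x) = - a x" if "x \<in> V" for x
    using scale[OF that, of "- 1"] by simp
  show "a (x - y) = a x - a y" if "x \<in> V" "y \<in> V"
    using add[OF that(1), of "- y"] neg[OF that(2)] carrier_scale[OF that(2), of "- 1"] by simp
qed

text \<open>The coordinates with respect to a basis of \<open>V\<close>, extended by zero off \<open>V\<close>.\<close>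

lemma coordinate_functionals:
  "\<exists>E e. finite E \<and> E \<subseteq> V \<and> (\<forall>i. e i \<in> dual s V) \<and>
     (\<forall>x\<in>V. (\<Sum>i\<in>E. s (e i x) i) = x)"
proof -
  obtain C where C: "finite C" "V = span C" using finitely_spanned by blast
  obtain E where E: "E \<subseteq> V" "independent E" "V \<subseteq> span E"
    using basis_exists[of V] by metis
  have finE: "finite E"
    using independent_span_bound[OF C(1) E(2)] E(1) C(2) by simp
  have VE: "V = span E"
    using E(1,3) span_mono[of E "span C"] span_span[of C] C(2) by auto
  define e where "e = (\<lambda>i x. representation E x i)"
  have "e i \<in> dual s V" for i
    using E VE
    by (simp add: dual_iff e_def representation_add representation_scale)
       (simp add: representation_def)
  moreover have "(\<Sum>i\<in>E. s (e i x) i) = x" if "x \<in> V" for x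
    unfolding e_def using sum_representation_eq[OF E(2) _ finE, of x] that VE by simp
  ultimately show ?thesis using finE E(1) by blast
qed

lemma dual_separates:
  assumes "x \<in> V" "y \<in> V" "\<And>a. a \<in> dual s V \<Longrightarrow> a x = a y"
  shows "x = y"
proof -
  obtain E e where e: "\<And>i. e i \<in> dual s V"
    and expand: "\<And>x. x \<in> V \<Longrightarrow> (\<Sum>i\<in>E. s (e i x) i) = x"
    using coordinate_functionals by blast
  have "(\<Sum>i\<in>E. s (e i x) i) = (\<Sum>i\<in>E. s (e i y) i)"
    by (simp only: assms(3)[OF e])
  then show ?thesis using expand assms(1,2) by simp
qed

lemma carrier_sum:
  assumes "finite I" "\<And>i. i \<in> I \<Longrightarrow> f i \<in> V"
  shows "(\<Sum>i\<in>I. f i) \<in> V"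
  using assms by (induction I rule: finite_induct) (simp_all add: carrier_zero carrier_add)

lemma dual_sum:
  assumes "a \<in> dual s V" "finite I" "\<And>i. i \<in> I \<Longrightarrow> f i \<in> V"
  shows "a (\<Sum>i\<in>I. f i) = (\<Sum>i\<in>I. a (f i))"
  using assms(2,3)
proof (induction I rule: finite_induct)
  case empty
  show ?case using dual_apply_linear(2)[OF assms(1) carrier_zero, of 0] by simp
next
  case (insert i I)
  then show ?case using dual_apply_linear(1)[OF assms(1)] carrier_sum[of I f] by simp
qed

text \<open>The coordinate functionals span the dual, because \<open>a = \<Sum>\<^sub>i a(i) e\<^sub>i\<close>.\<close>

lemma fd_space_dual: "fd_space fscale (dual s V)"
proof -
  interpret F: vector_space "fscale :: 'k \<Rightarrow> ('v \<Rightarrow> 'k) \<Rightarrow> _"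
    by (rule vector_space_fscale)
  obtain E e where E: "finite E" "E \<subseteq> V" and e: "\<And>i. e i \<in> dual s V"
    and expand: "\<And>x. x \<in> V \<Longrightarrow> (\<Sum>i\<in>E. s (e i x) i) = x"
    using coordinate_functionals by blast
  have sum_app: "(\<Sum>i\<in>I. g i) z = (\<Sum>i\<in>I. g i z)" for g :: "_ \<Rightarrow> 'v \<Rightarrow> 'k" and I :: "'v set" and z
    by (induction I rule: infinite_finite_induct) auto
  have "a = (\<Sum>i\<in>E. fscale (a i) (e i))" if a: "a \<in> dual s V" for a
  proof
    fix x
    show "a x = (\<Sum>i\<in>E. fscale (a i) (e i)) x"
    proof (cases "x \<in> V")
      case True
      have "a x = a (\<Sum>i\<in>E. s (e i x) i)" by (simp add: expand[OF True])
      also have "\<dots> = (\<Sum>i\<in>E. a (s (e i x) i))"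
        using dual_sum[OF a E(1), of "\<lambda>i. s (e i x) i"] E(2) carrier_scale by blast
      also have "\<dots> = (\<Sum>i\<in>E. fscale (a i) (e i)) x"
        using E(2) by (auto simp: sum_app fscale_def dual_apply_linear(2)[OF a] intro!: sum.cong)
      finally show ?thesis .
    next
      case False
      then show ?thesis using a e by (simp add: sum_app fscale_def dual_iff)
    qed
  qed
  then have "dual s V \<subseteq> F.span (e ` E)"
    by (metis (no_types, lifting) F.span_sum F.span_scale F.span_base imageI subsetI)
  moreover have "F.span (e ` E) \<subseteq> dual s V"
    by (rule F.span_minimal)
       (auto simp: e F.subspace_def dual_zero dual_add dual_scale)
  ultimately show ?thesis
    using E(1) by unfold_locales (metis finite_imageI subset_antisym)
qed

lemma linear_dual_map:
  assumes "linear_on s V s V f"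
  shows "linear_on fscale (dual s V) fscale (dual s V) (dual_map V f)"
  using dual_map_in_dual[OF fd_space_axioms assms]
  by (auto simp: linear_on_def dual_map_def fscale_def fun_eq_iff)

end


section \<open>The coadjoint representation\<close>

context involutive_nijenhuis_bihom_lie_algebra
begin

lemma map_closed:
  "x \<in> L \<Longrightarrow> \<alpha> x \<in> L" "x \<in> L \<Longrightarrow> \<beta> x \<in> L" "x \<in> L \<Longrightarrow> N x \<in> L"
  "\<lbrakk>x \<in> L; y \<in> L\<rbrakk> \<Longrightarrow> br x y \<in> L"
  using linear_alpha linear_beta linear_N bilinear_bracket
  by (auto simp: linear_on_def bilinear_on_def)

lemma bracket_linear:
  shows "\<lbrakk>x \<in> L; y \<in> L; z \<in> L\<rbrakk> \<Longrightarrow> br (x + y) z = br x z + br y z"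
    and "\<lbrakk>x \<in> L; y \<in> L; z \<in> L\<rbrakk> \<Longrightarrow> br z (x + y) = br z x + br z y"
    and "\<lbrakk>x \<in> L; z \<in> L\<rbrakk> \<Longrightarrow> br (s c x) z = s c (br x z)"
    and "\<lbrakk>x \<in> L; z \<in> L\<rbrakk> \<Longrightarrow> br z (s c x) = s c (br z x)"
    and "\<lbrakk>x \<in> L; z \<in> L\<rbrakk> \<Longrightarrow> br z (- x) = - br z x"
proof -
  show "\<lbrakk>x \<in> L; y \<in> L; z \<in> L\<rbrakk> \<Longrightarrow> br (x + y) z = br x z + br y z"
    "\<lbrakk>x \<in> L; y \<in> L; z \<in> L\<rbrakk> \<Longrightarrow> br z (x + y) = br z x + br z y"
    "\<lbrakk>x \<in> L; z \<in> L\<rbrakk> \<Longrightarrow> br (s c x) z = s c (br x z)"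
    and scale: "\<lbrakk>x \<in> L; z \<in> L\<rbrakk> \<Longrightarrow> br z (s c x) = s c (br z x)" for c
    using bilinear_bracket by (auto simp: linear_on_def bilinear_on_def)
  show "\<lbrakk>x \<in> L; z \<in> L\<rbrakk> \<Longrightarrow> br z (- x) = - br z x"
    using scale[of "- 1"] by simp
qed

text \<open>
  The skew-symmetry axiom constrains only brackets \<open>[\<beta> x, \<alpha> y]\<close>. For involutive twists every
  bracket has this shape, and the axiom becomes a rule for exchanging arbitrary arguments.
\<close>

lemma bracket_swap:
  assumes "x \<in> L" "y \<in> L"
  shows "br x y = - br (\<beta> (\<alpha> y)) (\<beta> (\<alpha> x))"
  using bihom_skew[of "\<beta> x" "\<alpha> y"] assms
  by (simp add: map_closed alpha_involutive beta_involutive alpha_beta)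

text \<open>
  The BiHom-Jacobi identity for \<open>\<alpha> x, y, \<alpha> z\<close>, with brackets exchanged so that \<open>z\<close> stands
  rightmost in every term. In this form it is the transpose of the bracket condition on \<open>ad\<^sup>*\<close>.
\<close>

lemma bracket_of_bracket:
  assumes "x \<in> L" "y \<in> L" "z \<in> L"
  shows "br (br x (\<beta> y)) (\<beta> z) = br (\<alpha> x) (br (\<beta> y) z) - br y (br (\<alpha> (\<beta> x)) z)"
proof -
  have "br (br x (\<beta> y)) (\<beta> z) = - br (\<alpha> z) (br (\<beta> (\<alpha> x)) (\<alpha> y))"
    using bracket_swap[of "br x (\<beta> y)" "\<beta> z"] assms
    by (simp add: map_closed alpha_bracket beta_bracket alpha_beta beta_involutive)
  moreover have "br (\<alpha> x) (br (\<beta> y) z) + br y (br (\<beta> (\<alpha> z)) x) + br (\<alpha> z) (br (\<beta> (\<alpha> x)) (\<alpha> y)) = 0"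
    using bihom_jacobi[of "\<alpha> x" y "\<alpha> z"] assms
    by (simp add: map_closed alpha_involutive beta_involutive)
  moreover have "br (\<beta> (\<alpha> z)) x = - br (\<alpha> (\<beta> x)) z"
    using bracket_swap[of "\<beta> (\<alpha> z)" x] assms
    by (simp add: map_closed alpha_involutive beta_involutive alpha_beta)
  ultimately show ?thesis
    using assms by (simp add: map_closed bracket_linear algebra_simps)
qed

text \<open>
  The representation that admissibility asks for is automatic. Involutivity makes \<open>\<alpha>\<^sup>*\<close> and \<open>\<beta>\<^sup>*\<close>
  intertwine \<open>ad\<^sup>*\<close>: on the dual they act contravariantly, and so \<open>\<alpha>\<^sup>* (ad\<^sup>* x a)\<close> pairs \<open>a\<close> with \<open>[x, \<alpha> y]\<close>
  while \<open>ad\<^sup>* (\<alpha> x) (\<alpha>\<^sup>* a)\<close> pairs it with \<open>[\<alpha>\<^sup>2 x, \<alpha> y]\<close>. The bracket condition is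
  \<open>bracket_of_bracket\<close>, and the Nijenhuis condition for \<open>T\<^sup>*\<close> is \<open>adm\<close> paired with a functional.
\<close>

lemma adjoint_admissibleI:
  assumes T: "linear_on s L s L T"
    and T_alpha: "\<And>x. x \<in> L \<Longrightarrow> T (\<alpha> x) = \<alpha> (T x)"
    and T_beta: "\<And>x. x \<in> L \<Longrightarrow> T (\<beta> x) = \<beta> (T x)"
    and adm: "\<And>x y. \<lbrakk>x \<in> L; y \<in> L\<rbrakk> \<Longrightarrow>
      T (br (N x) y) + br x (T (T y)) = br (N x) (T y) + T (br x (T y))"
  shows "adjoint_admissible s L br N \<alpha> \<beta> T"
proof -
  interpret M: fd_space fscale "dual s L" by (rule fd_space_dual)
  have T_closed: "T x \<in> L" if "x \<in> L" for x
    using T that by (simp add: linear_on_def)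
  have T_lin: "T (x + y) = T x + T y" if "x \<in> L" "y \<in> L" for x y
    using T that by (simp add: linear_on_def)
  note closed = map_closed T_closed
  have ad: "ad_star L br x a \<in> dual s L" if "x \<in> L" "a \<in> dual s L" for x a
    using that
    by (simp add: ad_star_def dual_iff map_closed carrier_add carrier_scale bracket_linear)
  have rho: "bilinear_on s L fscale (dual s L) fscale (dual s L) (ad_star L br)"
    unfolding bilinear_on_def linear_on_def
    by (auto simp: ad)
       (auto simp: ad_star_def fun_eq_iff fscale_def map_closed bracket_linear dual_apply_linear)
  have "nijenhuis_bihom_lie_representation s L br N \<alpha> \<beta> fscale (dual s L)
         (ad_star L br) (dual_map L T) (dual_map L \<alpha>) (dual_map L \<beta>)"
  proof unfold_locales
    show "bilinear_on s L fscale (dual s L) fscale (dual s L) (ad_star L br)" by (rule rho)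
    show "linear_on fscale (dual s L) fscale (dual s L) (dual_map L \<alpha>)"
      "linear_on fscale (dual s L) fscale (dual s L) (dual_map L \<beta>)"
      "linear_on fscale (dual s L) fscale (dual s L) (dual_map L T)"
      using linear_alpha linear_beta T by (simp_all add: linear_dual_map)
  next
    fix v assume "v \<in> dual s L"
    show "dual_map L \<alpha> (dual_map L \<beta> v) = dual_map L \<beta> (dual_map L \<alpha> v)"
      "dual_map L T (dual_map L \<alpha> v) = dual_map L \<alpha> (dual_map L T v)"
      "dual_map L T (dual_map L \<beta> v) = dual_map L \<beta> (dual_map L T v)"
      by (auto simp: dual_map_def fun_eq_iff closed alpha_beta T_alpha T_beta)
  next
    fix x v assume xv: "x \<in> L" "v \<in> dual s L"
    show "dual_map L \<alpha> (ad_star L br x v) = ad_star L br (\<alpha> x) (dual_map L \<alpha> v)"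
      "dual_map L \<beta> (ad_star L br x v) = ad_star L br (\<beta> x) (dual_map L \<beta> v)"
      using xv by (auto simp: dual_map_def ad_star_def fun_eq_iff closed alpha_bracket beta_bracket
          alpha_involutive beta_involutive)
    show "ad_star L br (N x) (dual_map L T v) =
      dual_map L T (ad_star L br (N x) v) + dual_map L T (ad_star L br x (dual_map L T v))
        - dual_map L T (dual_map L T (ad_star L br x v))"
    proof
      fix y
      have "v (T (br (N x) y)) + v (br x (T (T y))) = v (br (N x) (T y)) + v (T (br x (T y)))"
        if "y \<in> L"
        using arg_cong[OF adm[OF xv(1) that], of v] xv that
        by (simp add: closed dual_apply_linear)
      then show "ad_star L br (N x) (dual_map L T v) y =
        (dual_map L T (ad_star L br (N x) v) + dual_map L T (ad_star L br x (dual_map L T v))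
          - dual_map L T (dual_map L T (ad_star L br x v))) y"
        using xv by (simp add: dual_map_def ad_star_def closed algebra_simps)
    qed
  next
    fix x y v assume xyv: "x \<in> L" "y \<in> L" "v \<in> dual s L"
    show "ad_star L br (br (\<beta> x) y) (dual_map L \<beta> v) =
      ad_star L br (\<alpha> (\<beta> x)) (ad_star L br y v) - ad_star L br (\<beta> y) (ad_star L br (\<alpha> x) v)"
    proof
      fix z
      have "v (\<beta> (br (br (\<beta> x) y) z)) = v (br (\<alpha> x) (br (\<beta> y) z)) - v (br y (br (\<alpha> (\<beta> x)) z))"
        if "z \<in> L"
        using bracket_of_bracket[OF xyv(1,2) that] xyv that
        by (simp add: closed beta_bracket beta_involutive dual_apply_linear)
      then show "ad_star L br (br (\<beta> x) y) (dual_map L \<beta> v) z =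
        (ad_star L br (\<alpha> (\<beta> x)) (ad_star L br y v) - ad_star L br (\<beta> y) (ad_star L br (\<alpha> x) v)) z"
        using xyv by (simp add: dual_map_def ad_star_def closed algebra_simps)
    qed
  qed
  with T adm show ?thesis
    by (intro adjoint_admissible.intro adjoint_admissible_axioms.intro
        involutive_nijenhuis_bihom_lie_algebra_axioms)
qed

end

context adjoint_admissible
begin

lemma S_closed: "x \<in> L \<Longrightarrow> S x \<in> L"
  using linear_S by (simp add: linear_on_def)

lemma S_minus: "x \<in> L \<Longrightarrow> S (- x) = - S x"
proof -
  assume "x \<in> L"
  then have "S (s (- 1) x) = s (- 1) (S x)"
    using linear_S unfolding linear_on_def by blast
  then show ?thesis by simp
qed

text \<open>
  Admissibility only says that \<open>S\<^sup>*\<close> commutes with \<open>\<alpha>\<^sup>*\<close> and \<open>\<beta>\<^sup>*\<close>; functionals separate points,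
  so \<open>S\<close> itself commutes with the twists.
\<close>

lemma S_alpha: "x \<in> L \<Longrightarrow> S (\<alpha> x) = \<alpha> (S x)"
  and S_beta: "x \<in> L \<Longrightarrow> S (\<beta> x) = \<beta> (S x)"
proof -
  interpret R: nijenhuis_bihom_lie_representation s L br N \<alpha> \<beta> fscale "dual s L"
    "ad_star L br" "dual_map L S" "dual_map L \<alpha>" "dual_map L \<beta>"
    by (rule dual_representation)
  assume x: "x \<in> L"
  show "S (\<alpha> x) = \<alpha> (S x)"
  proof (rule dual_separates)
    fix a assume "a \<in> dual s L"
    from fun_cong[OF R.eta_p[OF this], of x] show "a (S (\<alpha> x)) = a (\<alpha> (S x))"
      using x by (simp add: dual_map_def S_closed map_closed)
  qed (simp_all add: x S_closed map_closed)
  show "S (\<beta> x) = \<beta> (S x)"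
  proof (rule dual_separates)
    fix a assume "a \<in> dual s L"
    from fun_cong[OF R.eta_q[OF this], of x] show "a (S (\<beta> x)) = a (\<beta> (S x))"
      using x by (simp add: dual_map_def S_closed map_closed)
  qed (simp_all add: x S_closed map_closed)
qed

text \<open>
  This is the admissibility equation at \<open>(\<beta> \<alpha> y, \<beta> \<alpha> x)\<close>, all four brackets being exchanged by
  \<open>bracket_swap\<close>; \<open>S\<close> and \<open>N\<close> pass through the twists.
\<close>

lemma admissible_swapped:
  assumes "x \<in> L" "y \<in> L"
  shows "S (br x (N y)) + br (S (S x)) y = S (br (S x) y) + br (S x) (N y)"
proof -
  note simps = map_closed S_closed S_alpha S_beta N_alpha N_beta alpha_involutive beta_involutive
  have swap: "br (\<beta> (\<alpha> u)) (\<beta> (\<alpha> v)) = - br v u" if "u \<in> L" "v \<in> L" for u v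
    using bracket_swap[of v u] that by simp
  have "- S (br x (N y)) - br (S (S x)) y = - br (S x) (N y) - S (br (S x) y)"
    using admissible[of "\<beta> (\<alpha> y)" "\<beta> (\<alpha> x)"] swap[of "N y" x] swap[of y "S (S x)"]
      swap[of "N y" "S x"] swap[of y "S x"] assms
    by (simp add: simps S_minus)
  then have "- (- S (br x (N y)) - br (S (S x)) y) = - (- br (S x) (N y) - S (br (S x) y))"
    by (rule arg_cong)
  then show ?thesis by (simp add: add.commute)
qed

end


section \<open>The dual of a coalgebra\<close>

context bihom_lie_coalgebra
begin

lemma cobracket_bilinear:
  assumes "x \<in> L"
  shows "bilinear_on fscale (dual s L) fscale (dual s L) (*) UNIV (\<lambda>a b. \<Delta> x (a, b))"
  using tensor_bilinear(1)[OF fd_space_axioms] linear_cobracket assms by (simp add: linear_on_def)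

lemma dual_bracket_in_dual: "dual_bracket L \<Delta> a b \<in> dual s L"
  using linear_cobracket
  by (simp add: dual_bracket_def dual_iff linear_on_def fscale_def carrier_add carrier_scale)

lemma dual_maps_in_dual:
  "a \<in> dual s L \<Longrightarrow> dual_map L \<alpha> a \<in> dual s L" "a \<in> dual s L \<Longrightarrow> dual_map L \<beta> a \<in> dual s L"
  using dual_map_in_dual[OF fd_space_axioms] co_linear_alpha co_linear_beta by auto

text \<open>
  Each axiom of the algebra is the corresponding axiom of the coalgebra, evaluated at functionals.
  For the Jacobi identity, the value of \<open>J\<close> at \<open>(a, b, c)\<close> is the double bracket
  \<open>[\<beta>\<^sup>* \<beta>\<^sup>* a, [\<beta>\<^sup>* b, \<alpha>\<^sup>* c]]\<close>, and the two permuted copies of \<open>J\<close> evaluate it at the cyclic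
  permutations \<open>(b, c, a)\<close> and \<open>(c, a, b)\<close>.
\<close>

lemma bihom_lie_algebra_dual:
  "bihom_lie_algebra fscale (dual s L) (dual_bracket L \<Delta>) (dual_map L \<alpha>) (dual_map L \<beta>)"
proof -
  interpret M: fd_space fscale "dual s L" by (rule fd_space_dual)
  have closed: "\<alpha> x \<in> L" "\<beta> x \<in> L" if "x \<in> L" for x
    using co_linear_alpha co_linear_beta that by (auto simp: linear_on_def)
  show ?thesis
  proof unfold_locales
    show "bilinear_on fscale (dual s L) fscale (dual s L) fscale (dual s L) (dual_bracket L \<Delta>)"
      using cobracket_bilinear unfolding bilinear_on_def linear_on_def
      by (auto simp: dual_bracket_in_dual)
         (auto simp: dual_bracket_def fscale_def fun_eq_iff)
    show "linear_on fscale (dual s L) fscale (dual s L) (dual_map L \<alpha>)"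
      "linear_on fscale (dual s L) fscale (dual s L) (dual_map L \<beta>)"
      using co_linear_alpha co_linear_beta by (simp_all add: linear_dual_map)
  next
    fix a assume "a \<in> dual s L"
    show "dual_map L \<alpha> (dual_map L \<beta> a) = dual_map L \<beta> (dual_map L \<alpha> a)"
      by (auto simp: dual_map_def fun_eq_iff closed co_alpha_beta)
  next
    fix a b assume ab: "a \<in> dual s L" "b \<in> dual s L"
    show "dual_map L \<alpha> (dual_bracket L \<Delta> a b) = dual_bracket L \<Delta> (dual_map L \<alpha> a) (dual_map L \<alpha> b)"
      "dual_map L \<beta> (dual_bracket L \<Delta> a b) = dual_bracket L \<Delta> (dual_map L \<beta> a) (dual_map L \<beta> b)"
      using ab by (auto simp: dual_bracket_def dual_map_apply fun_eq_iff closed cobracket_alpha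
          cobracket_beta tensor_map_def) (auto simp: dual_map_def)
    have "\<Delta> x (dual_map L \<beta> a, dual_map L \<alpha> b) = - \<Delta> x (dual_map L \<beta> b, dual_map L \<alpha> a)"
      if "x \<in> L" for x
      using fun_cong[OF co_skew[OF that], of "(a, b)"] ab
      by (simp add: flip_def tensor_map_def eq_neg_iff_add_eq_0)
    then show "dual_bracket L \<Delta> (dual_map L \<beta> a) (dual_map L \<alpha> b) =
      - dual_bracket L \<Delta> (dual_map L \<beta> b) (dual_map L \<alpha> a)"
      by (auto simp: dual_bracket_def fun_eq_iff)
  next
    fix a b c assume abc: "a \<in> dual s L" "b \<in> dual s L" "c \<in> dual s L"
    have J: "co_jacobiator s L \<Delta> \<alpha> \<beta> x (u, v, w) =
        \<Delta> x (dual_map L \<beta> (dual_map L \<beta> u), dual_bracket L \<Delta> (dual_map L \<beta> v) (dual_map L \<alpha> w))"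
      if "u \<in> dual s L" "v \<in> dual s L" "w \<in> dual s L" for x u v w
    proof -
      have "dual_map L (\<beta> \<circ> \<beta>) u = dual_map L \<beta> (dual_map L \<beta> u)"
        by (auto simp: dual_map_def fun_eq_iff closed)
      then show ?thesis
        using that by (simp add: co_jacobiator_def tensor_map3_def tensor_cobracket_def
            dual_map_id dual_maps_in_dual)
    qed
    show "dual_bracket L \<Delta> (dual_map L \<beta> (dual_map L \<beta> a)) (dual_bracket L \<Delta> (dual_map L \<beta> b) (dual_map L \<alpha> c))
      + dual_bracket L \<Delta> (dual_map L \<beta> (dual_map L \<beta> b)) (dual_bracket L \<Delta> (dual_map L \<beta> c) (dual_map L \<alpha> a))
      + dual_bracket L \<Delta> (dual_map L \<beta> (dual_map L \<beta> c)) (dual_bracket L \<Delta> (dual_map L \<beta> a) (dual_map L \<alpha> b)) = 0"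
    proof
      fix x
      have "co_jacobiator s L \<Delta> \<alpha> \<beta> x (a, b, c) + co_jacobiator s L \<Delta> \<alpha> \<beta> x (b, c, a)
          + co_jacobiator s L \<Delta> \<alpha> \<beta> x (c, a, b) = 0" if "x \<in> L"
        using fun_cong[OF co_jacobi[OF that], of "(a, b, c)"] by (simp add: flip12_def flip23_def)
      then show "(dual_bracket L \<Delta> (dual_map L \<beta> (dual_map L \<beta> a)) (dual_bracket L \<Delta> (dual_map L \<beta> b) (dual_map L \<alpha> c))
      + dual_bracket L \<Delta> (dual_map L \<beta> (dual_map L \<beta> b)) (dual_bracket L \<Delta> (dual_map L \<beta> c) (dual_map L \<alpha> a))
      + dual_bracket L \<Delta> (dual_map L \<beta> (dual_map L \<beta> c)) (dual_bracket L \<Delta> (dual_map L \<beta> a) (dual_map L \<alpha> b))) x = 0 x"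
        using J abc by (simp add: dual_bracket_def[of L \<Delta> "dual_map L \<beta> (dual_map L \<beta> _)"])
    qed
  qed
qed

end

lemma (in nijenhuis_bihom_lie_coalgebra) involutive_nijenhuis_bihom_lie_algebra_dual:
  assumes "\<And>x. x \<in> L \<Longrightarrow> \<alpha> (\<alpha> x) = x" "\<And>x. x \<in> L \<Longrightarrow> \<beta> (\<beta> x) = x"
    and "\<And>x. x \<in> L \<Longrightarrow> S (\<alpha> x) = \<alpha> (S x)" "\<And>x. x \<in> L \<Longrightarrow> S (\<beta> x) = \<beta> (S x)"
  shows "involutive_nijenhuis_bihom_lie_algebra fscale (dual s L) (dual_bracket L \<Delta>)
    (dual_map L S) (dual_map L \<alpha>) (dual_map L \<beta>)"
proof -
  interpret D: bihom_lie_algebra fscale "dual s L" "dual_bracket L \<Delta>" "dual_map L \<alpha>" "dual_map L \<beta>"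
    by (rule bihom_lie_algebra_dual)
  have closed: "\<alpha> x \<in> L" "\<beta> x \<in> L" "S x \<in> L" if "x \<in> L" for x
    using co_linear_alpha co_linear_beta co_linear_S that by (auto simp: linear_on_def)
  show ?thesis
  proof unfold_locales
    show "linear_on fscale (dual s L) fscale (dual s L) (dual_map L S)"
      using co_linear_S by (rule linear_dual_map)
  next
    fix a assume "a \<in> dual s L"
    then show "dual_map L \<alpha> (dual_map L \<alpha> a) = a" "dual_map L \<beta> (dual_map L \<beta> a) = a"
      "dual_map L S (dual_map L \<alpha> a) = dual_map L \<alpha> (dual_map L S a)"
      "dual_map L S (dual_map L \<beta> a) = dual_map L \<beta> (dual_map L S a)"
      by (auto simp: dual_map_def fun_eq_iff closed assms dual_iff)
  next
    fix a b assume ab: "a \<in> dual s L" "b \<in> dual s L"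
    have co: "\<Delta> x (dual_map L S a, dual_map L S b) =
        \<Delta> (S x) (dual_map L S a, b) + \<Delta> (S x) (a, dual_map L S b) - \<Delta> (S (S x)) (a, b)"
      if "x \<in> L" for x
      using fun_cong[OF co_nijenhuis[OF that], of "(a, b)"] ab
      by (simp add: tensor_map_def dual_map_id eq_diff_eq)
    show "dual_bracket L \<Delta> (dual_map L S a) (dual_map L S b) =
      dual_map L S (dual_bracket L \<Delta> (dual_map L S a) b + dual_bracket L \<Delta> a (dual_map L S b))
        - dual_map L S (dual_map L S (dual_bracket L \<Delta> a b))" (is "?l = ?r")
    proof
      fix x
      show "?l x = ?r x"
        using co[of x]
        by (cases "x \<in> L")
          (simp_all add: dual_map_apply dual_bracket_apply closed, simp add: dual_map_def dual_bracket_def)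
    qed
  qed
qed


section \<open>Coboundaries of skew tensors intertwining \<open>S\<close> and \<open>N\<close>\<close>

context adjoint_admissible
begin

lemma dual_closed:
  "a \<in> dual s L \<Longrightarrow> dual_map L \<beta> a \<in> dual s L"
  "a \<in> dual s L \<Longrightarrow> dual_map L N a \<in> dual s L"
  "a \<in> dual s L \<Longrightarrow> dual_map L S a \<in> dual s L"
  "a \<in> dual s L \<Longrightarrow> x \<in> L \<Longrightarrow> dual_map L (br x) a \<in> dual s L"
  using dual_map_in_dual[OF fd_space_axioms] linear_beta linear_N linear_S bilinear_bracket
  by (auto simp: bilinear_on_def)

lemma dual_commute:
  "dual_map L \<beta> (dual_map L S a) = dual_map L S (dual_map L \<beta> a)"
  "dual_map L \<beta> (dual_map L N a) = dual_map L N (dual_map L \<beta> a)"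
  by (auto simp: dual_map_def fun_eq_iff map_closed S_closed S_beta N_beta)

lemma coboundary_apply:
  assumes "x \<in> L" "a \<in> dual s L" "b \<in> dual s L"
  shows "coboundary s L br \<alpha> \<beta> r x (a, b) =
    r (dual_map L (br x) a, dual_map L \<beta> b) + r (dual_map L \<beta> a, dual_map L (br (\<alpha> (\<beta> x))) b)"
proof -
  have "inj_on \<alpha> L" by (metis alpha_involutive inj_onI)
  then have "inv_into L \<alpha> (\<beta> x) = \<alpha> (\<beta> x)"
    using assms(1) by (metis alpha_involutive inv_into_f_f map_closed(1,2))
  then show ?thesis using assms by (simp add: coboundary_def tensor_map_def)
qed

text \<open>
  Admissibility of \<open>S\<close> (with and without exchanged factors) and the Nijenhuis identity of \<open>N\<close>, each
  read as an equation between endomorphisms of \<open>L\<close> in the free bracket argument and transposed.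
\<close>

lemma transposed_identities:
  assumes "x \<in> L" "a \<in> dual s L"
  shows admissible_swapped_dual:
      "dual_map L N (dual_map L (br x) (dual_map L S a)) + dual_map L (br (S (S x))) a =
      dual_map L (br (S x)) (dual_map L S a) + dual_map L N (dual_map L (br (S x)) a)"
    and admissible_dual:
      "dual_map L (br (N x)) (dual_map L S a) + dual_map L S (dual_map L S (dual_map L (br x) a)) =
      dual_map L S (dual_map L (br x) (dual_map L S a)) + dual_map L S (dual_map L (br (N x)) a)"
    and nijenhuis_dual:
      "dual_map L N (dual_map L (br (N x)) a) + dual_map L (br x) (dual_map L N (dual_map L N a)) =
      dual_map L N (dual_map L (br x) (dual_map L N a)) + dual_map L (br (N x)) (dual_map L N a)"
proof -
  note c = map_closed S_closed
  have "a (S (br x (N z))) + a (br (S (S x)) z) = a (S (br (S x) z)) + a (br (S x) (N z))"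
    "a (S (br (N x) z)) + a (br x (S (S z))) = a (S (br x (S z))) + a (br (N x) (S z))"
    "a (br (N x) (N z)) + a (N (N (br x z))) = a (N (br x (N z))) + a (N (br (N x) z))"
    if z: "z \<in> L" for z
  proof -
    show "a (S (br x (N z))) + a (br (S (S x)) z) = a (S (br (S x) z)) + a (br (S x) (N z))"
      using arg_cong[OF admissible_swapped[OF assms(1) z], of a] assms z
      by (simp add: c dual_apply_linear)
    show "a (S (br (N x) z)) + a (br x (S (S z))) = a (S (br x (S z))) + a (br (N x) (S z))"
      using arg_cong[OF admissible[OF assms(1) z], of a] assms z
      by (simp add: c dual_apply_linear)
    have "N (br (N x) z + br x (N z)) = N (br (N x) z) + N (br x (N z))"
      using linear_N assms z by (simp add: linear_on_def map_closed)
    then show "a (br (N x) (N z)) + a (N (N (br x z))) = a (N (br x (N z))) + a (N (br (N x) z))"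
      using arg_cong[OF nijenhuis[OF assms(1) z], of a] assms z
      by (simp add: c dual_apply_linear carrier_add)
  qed
  then show "dual_map L N (dual_map L (br x) (dual_map L S a)) + dual_map L (br (S (S x))) a =
      dual_map L (br (S x)) (dual_map L S a) + dual_map L N (dual_map L (br (S x)) a)"
    "dual_map L (br (N x)) (dual_map L S a) + dual_map L S (dual_map L S (dual_map L (br x) a)) =
      dual_map L S (dual_map L (br x) (dual_map L S a)) + dual_map L S (dual_map L (br (N x)) a)"
    "dual_map L N (dual_map L (br (N x)) a) + dual_map L (br x) (dual_map L N (dual_map L N a)) =
      dual_map L N (dual_map L (br x) (dual_map L N a)) + dual_map L (br (N x)) (dual_map L N a)"
    using assms(1) by (auto simp: fun_eq_iff dual_map_def c)
qed

context
  fixes r :: "('v \<Rightarrow> 'k) \<times> ('v \<Rightarrow> 'k) \<Rightarrow> 'k"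
  assumes r_tensor: "r \<in> tensor s L"
    and r_skew: "r = - flip r"
    and r_intertwines: "tensor_map s L S id r - tensor_map s L id N r = 0"
begin

lemma r_add:
  assumes "a \<in> dual s L" "b \<in> dual s L" "c \<in> dual s L"
  shows "r (a + b, c) = r (a, c) + r (b, c)" "r (c, a + b) = r (c, a) + r (c, b)"
  using tensor_bilinear(1)[OF fd_space_axioms r_tensor] assms
  by (auto simp: bilinear_on_def linear_on_def)

text \<open>
  The intertwining hypothesis is the first rule. Skewness exchanges the arguments of \<open>r\<close> and so
  turns it into the second one, in which \<open>S\<close> and \<open>N\<close> have exchanged sides.
\<close>

lemma r_move:
  assumes "a \<in> dual s L" "b \<in> dual s L"
  shows r_S_left: "r (dual_map L S a, b) = r (a, dual_map L N b)"
    and r_S_right: "r (a, dual_map L S b) = r (dual_map L N a, b)"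
proof -
  have left: "r (dual_map L S a, b) = r (a, dual_map L N b)"
    if "a \<in> dual s L" "b \<in> dual s L" for a b
    using fun_cong[OF r_intertwines, of "(a, b)"] that
    by (simp add: tensor_map_def dual_map_id)
  then show "r (dual_map L S a, b) = r (a, dual_map L N b)" using assms .
  have skew: "r (u, v) = - r (v, u)" for u v
    using fun_cong[OF r_skew, of "(u, v)"] by (simp add: flip_def)
  show "r (a, dual_map L S b) = r (dual_map L N a, b)"
    using left[OF assms(2,1)] skew by metis
qed

text \<open>
  With all operators moved next to the bracket, both summands of the coboundary reduce to
  \<open>admissible_swapped_dual\<close>, at \<open>x\<close> in the first argument and at \<open>y = \<alpha> (\<beta> x)\<close> in the second.
\<close>

lemma coboundary_co_nijenhuis:
  assumes x: "x \<in> L" and ab: "a \<in> dual s L" "b \<in> dual s L"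
  defines "\<Delta> \<equiv> coboundary s L br \<alpha> \<beta> r"
  shows "\<Delta> x (dual_map L S a, dual_map L S b) + \<Delta> (S (S x)) (a, b) =
    \<Delta> (S x) (dual_map L S a, b) + \<Delta> (S x) (a, dual_map L S b)"
proof -
  define y where "y = \<alpha> (\<beta> x)"
  have y: "y \<in> L" "\<alpha> (\<beta> (S x)) = S y" "\<alpha> (\<beta> (S (S x))) = S (S y)"
    using x by (simp_all add: y_def map_closed S_closed flip: S_alpha S_beta)
  note c = dual_closed map_closed S_closed
  let ?a = "dual_map L \<beta> a" and ?b = "dual_map L \<beta> b"
  have "r (dual_map L N (dual_map L (br x) (dual_map L S a)) + dual_map L (br (S (S x))) a, ?b) =
    r (dual_map L (br (S x)) (dual_map L S a) + dual_map L N (dual_map L (br (S x)) a), ?b)"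
    by (simp only: admissible_swapped_dual[OF x ab(1)])
  moreover have "r (?a, dual_map L N (dual_map L (br y) (dual_map L S b)) + dual_map L (br (S (S y))) b) =
    r (?a, dual_map L (br (S y)) (dual_map L S b) + dual_map L N (dual_map L (br (S y)) b))"
    by (simp only: admissible_swapped_dual[OF y(1) ab(2)])
  ultimately show ?thesis
    unfolding \<Delta>_def using x y ab
    by (simp add: coboundary_apply c r_add dual_commute r_move y_def[symmetric] algebra_simps)
qed

text \<open>
  The equation asked of \<open>N\<^sup>*\<close>, at a point \<open>x\<close> of \<open>L\<close>. Here the two summands of the coboundary need
  different identities: on the left \<open>N\<^sup>*\<close> turns into \<open>S\<^sup>*\<close> and leaves \<open>admissible_dual\<close>, on the
  right \<open>S\<^sup>*\<close> turns into \<open>N\<^sup>*\<close> and leaves \<open>nijenhuis_dual\<close>.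
\<close>

lemma coboundary_admissible:
  assumes x: "x \<in> L" and ab: "a \<in> dual s L" "b \<in> dual s L"
  defines "\<Delta> \<equiv> coboundary s L br \<alpha> \<beta> r"
  shows "\<Delta> (N x) (dual_map L S a, b) + \<Delta> x (a, dual_map L N (dual_map L N b)) =
    \<Delta> x (dual_map L S a, dual_map L N b) + \<Delta> (N x) (a, dual_map L N b)"
proof -
  define y where "y = \<alpha> (\<beta> x)"
  have y: "y \<in> L" "\<alpha> (\<beta> (N x)) = N y"
    using x by (simp_all add: y_def map_closed flip: N_alpha N_beta)
  note c = dual_closed map_closed S_closed
  let ?a = "dual_map L \<beta> a" and ?b = "dual_map L \<beta> b"
  have "r (dual_map L (br (N x)) (dual_map L S a) + dual_map L S (dual_map L S (dual_map L (br x) a)), ?b) =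
      r (dual_map L S (dual_map L (br x) (dual_map L S a)) + dual_map L S (dual_map L (br (N x)) a), ?b)"
    by (simp only: admissible_dual[OF x ab(1)])
  moreover have "r (?a, dual_map L N (dual_map L (br (N y)) b) + dual_map L (br y) (dual_map L N (dual_map L N b))) =
      r (?a, dual_map L N (dual_map L (br y) (dual_map L N b)) + dual_map L (br (N y)) (dual_map L N b))"
    by (simp only: nijenhuis_dual[OF y(1) ab(2)])
  ultimately show ?thesis
    unfolding \<Delta>_def using x y ab
    by (simp add: coboundary_apply c r_add dual_commute r_S_left y_def[symmetric] algebra_simps)
qed

end

end


theorem theorem2p52:
  fixes s :: "'k::field \<Rightarrow> 'v::ab_group_add \<Rightarrow> 'v" and L :: "'v set"
    and br :: "'v \<Rightarrow> 'v \<Rightarrow> 'v" and N S \<alpha> \<beta> :: "'v \<Rightarrow> 'v"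
    and r :: "('v \<Rightarrow> 'k) \<times> ('v \<Rightarrow> 'k) \<Rightarrow> 'k"
  assumes "involutive_nijenhuis_bihom_lie_algebra s L br N \<alpha> \<beta>"
    and "adjoint_admissible s L br N \<alpha> \<beta> S"
    and "r \<in> tensor s L"
    and "bihom_lie_bialgebra s L br (coboundary s L br \<alpha> \<beta> r) \<alpha> \<beta>"
    and "r = - flip r"
    and "tensor_map s L S id r - tensor_map s L id N r = 0"
  shows "nijenhuis_bihom_lie_bialgebra s L br N (coboundary s L br \<alpha> \<beta> r) S \<alpha> \<beta>"
proof -
  let ?\<Delta> = "coboundary s L br \<alpha> \<beta> r"
  interpret A: adjoint_admissible s L br N \<alpha> \<beta> S by fact
  interpret B: bihom_lie_bialgebra s L br ?\<Delta> \<alpha> \<beta> by fact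
  interpret C: nijenhuis_bihom_lie_coalgebra s L ?\<Delta> S \<alpha> \<beta>
  proof unfold_locales
    show "linear_on s L s L S" by (rule A.linear_S)
    fix x assume x: "x \<in> L"
    (* Off the dual, tensors vanish by convention, and the identity of functions needs this too. *)
    have vanish: "?\<Delta> z (a, b) = 0" if "z \<in> L" "\<not> (a \<in> dual s L \<and> b \<in> dual s L)" for z a b
      using tensor_bilinear(2)[OF A.fd_space_axioms, of "?\<Delta> z" a b] B.linear_cobracket that
      by (auto simp: linear_on_def)
    show "tensor_map s L S S (?\<Delta> x) + ?\<Delta> (S (S x)) =
      tensor_map s L S id (?\<Delta> (S x)) + tensor_map s L id S (?\<Delta> (S x))"
    proof (rule ext, clarify)
      fix a b
      show "(tensor_map s L S S (?\<Delta> x) + ?\<Delta> (S (S x))) (a, b) =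
        (tensor_map s L S id (?\<Delta> (S x)) + tensor_map s L id S (?\<Delta> (S x))) (a, b)"
        using A.coboundary_co_nijenhuis[OF assms(3,5,6) x, of a b]
          vanish[OF A.S_closed[OF A.S_closed[OF x]], of a b]
        by (auto simp: tensor_map_def dual_map_id)
    qed
  qed
  interpret D: involutive_nijenhuis_bihom_lie_algebra fscale "dual s L" "dual_bracket L ?\<Delta>"
    "dual_map L S" "dual_map L \<alpha>" "dual_map L \<beta>"
    using A.alpha_involutive A.beta_involutive A.S_alpha A.S_beta
    by (rule C.involutive_nijenhuis_bihom_lie_algebra_dual)
  have "adjoint_admissible fscale (dual s L) (dual_bracket L ?\<Delta>)
      (dual_map L S) (dual_map L \<alpha>) (dual_map L \<beta>) (dual_map L N)"
  proof (rule D.adjoint_admissibleI)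
    show "linear_on fscale (dual s L) fscale (dual s L) (dual_map L N)"
      using A.linear_N by (rule A.linear_dual_map)
  next
    fix a assume "a \<in> dual s L"
    show "dual_map L N (dual_map L \<alpha> a) = dual_map L \<alpha> (dual_map L N a)"
      "dual_map L N (dual_map L \<beta> a) = dual_map L \<beta> (dual_map L N a)"
      by (auto simp: dual_map_def fun_eq_iff A.map_closed A.N_alpha A.N_beta)
  next
    fix a b assume ab: "a \<in> dual s L" "b \<in> dual s L"
    show "dual_map L N (dual_bracket L ?\<Delta> (dual_map L S a) b)
        + dual_bracket L ?\<Delta> a (dual_map L N (dual_map L N b)) =
      dual_bracket L ?\<Delta> (dual_map L S a) (dual_map L N b)
        + dual_map L N (dual_bracket L ?\<Delta> a (dual_map L N b))"
    proof
      fix x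
      show "(dual_map L N (dual_bracket L ?\<Delta> (dual_map L S a) b)
          + dual_bracket L ?\<Delta> a (dual_map L N (dual_map L N b))) x =
        (dual_bracket L ?\<Delta> (dual_map L S a) (dual_map L N b)
          + dual_map L N (dual_bracket L ?\<Delta> a (dual_map L N b))) x"
        using A.coboundary_admissible[OF assms(3,5,6) _ ab, of x]
        by (cases "x \<in> L")
          (simp_all add: dual_map_apply dual_bracket_apply A.map_closed,
            simp add: dual_map_def dual_bracket_def)
    qed
  qed
  then show ?thesis
    using assms(1,2,4) C.nijenhuis_bihom_lie_coalgebra_axioms
    by (simp add: nijenhuis_bihom_lie_bialgebra_def)
qed

end
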